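(* Let $A\in\mathbb{R}^{n\times n}$, $B\in\mathbb{R}^{n\times m}$, $C\in\mathbb{R}^{m\times n}$, $D\in\mathbb{R}^{m\times m}$, where $A$ is Hurwitz stable and $\|D\|<1$. Suppose there exist $H\in\mathbb{S}_+^{n+m}$, $f,g\in\mathbb{R}_+^m$ and $X,Z\in\mathbb{Z}_0^m$, not all zero, such that, partitioning $H=\begin{bmatrix} H_{11} & H_{12} \\ H_{12}^T & H_{22} \end{bmatrix}$ with $H_{11}\in\mathbb{S}_+^n$, $H_{22}\in\mathbb{S}_+^m$, and setting $Y:=\begin{bmatrix} 0_{m,n} & I_m \end{bmatrix} H \begin{bmatrix} C^T \\ D^T-I_m \end{bmatrix}$, $$\mathrm{He}\{AH_{11}+BH_{12}^T\}=0,$$ $$\mathcal{P}_{\mathrm{d}}(Y)=\mathcal{P}_{\mathrm{d}}(\mathbf{1}_m f^T+g\mathbf{1}_m^T),\qquad \mathcal{P}_{\mathrm{od}}(Y)=\mathcal{P}_{\mathrm{od}}(X-Z),$$ $$\mathcal{P}_{\mathrm{od}}(X+Z)=-\mathcal{P}_{\mathrm{od}}(\mathbf{1}_m f^T+g\mathbf{1}_m^T),$$ and suppose that $\mathrm{rank}(H)=1$, with $$H=\begin{bmatrix} h_1 \\ h_2 \end{bmatrix}\begin{bmatrix} h_1 \\ h_2 \end{bmatrix}^T,\quad h_1\in\mathbb{R}^n,\ h_2\in\mathbb{R}^m.$$ Then the following assertions hold: (i) $h_1\neq 0$. (ii) Define $z^\ast:=Ch_1+Dh_2$ and $w^\ast:=h_2$.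 Then there exists an odd nonlinearity $\phi_{\mathrm{wc}}\in\mathrm{slope}[0,1]$ such that $\phi_{\mathrm{wc}}(z_i^\ast)=w_i^\ast$ and $\phi_{\mathrm{wc}}(-z_i^\ast)=-w_i^\ast$ for $i=1,\ldots,m$. (iii) Let $\phi_{\mathrm{wc}}$ be as in (ii) and define $\Phi_{\mathrm{wc}}:=\mathrm{diag}_m(\phi_{\mathrm{wc}})$. Then the feedback system $\Sigma$ with the nonlinearity $\Phi=\Phi_{\mathrm{wc}}\in\mathbf{\Phi}_{0,1}^m\cap\mathbf{\Phi}_{\mathrm{odd}}^m$ is not stable. In particular, the state $x$ of $\Sigma$ corresponding to the initial state $x(0)=h_1$ is given by $x(t)=h_1$ for all $t\ge 0$.
   Context: Notation: $\mathbb{S}_+^k$ is the set of $k\times k$ real symmetric positive semidefinite matrices; $\mathbb{R}_+^m$ is the set of entrywise nonnegative vectors; $I_m$ is the identity matrix, $0_{m,n}$ the $m\times n$ zero matrix, $\mathbf{1}_m\in\mathbb{R}^m$ the all-ones vector. For a square matrix $S$, $\mathrm{He}\{S\}:=S+S^T$. $\|D\|$ is the norm induced by the Euclidean norm. A matrix is Hurwitz stable if all its eigenvalues have negative real part. $\mathcal{P}_{\mathrm{d}}:\mathbb{R}^{m\times m}\to\mathbb{R}^{m\times m}$ is the projection onto the diagonal matrices (it keeps the diagonal entries and sets off-diagonal entries to zero), and $\mathcal{P}_{\mathrm{od}}$ is the projection onto matrices with zero diagonal (it keeps the off-diagonal entries and sets the diagonal to zero). $\mathbb{Z}_0^m$ is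 the set of matrices $X\in\mathbb{R}^{m\times m}$ with $X_{i,i}=0$ for all $i$ and $X_{i,j}\le 0$ for all $i\ne j$. For $\mu\le 0\le\nu$, $\phi\in\mathrm{slope}[\mu,\nu]$ means that $\phi:\mathbb{R}\to\mathbb{R}$ satisfies $\phi(0)=0$ and $\mu\le\frac{\phi(p)-\phi(q)}{p-q}\le\nu$ for all $p,q\in\mathbb{R}$, $p\neq q$. For $\phi:\mathbb{R}\to\mathbb{R}$, $\mathrm{diag}_m(\phi):\mathbb{R}^m\to\mathbb{R}^m$ applies $\phi$ to each of the $m$ components. $\mathbf{\Phi}_{\mu,\nu}^m:=\{\mathrm{diag}_m(\phi):\phi\in\mathrm{slope}[\mu,\nu]\}$ and $\mathbf{\Phi}_{\mathrm{odd}}^m:=\{\mathrm{diag}_m(\phi):\phi\text{ is odd}\}$. For a static nonlinearity $\Phi:\mathbb{R}^m\to\mathbb{R}^m$, the feedback system $\Sigma$ is $$\dot x(t)=Ax(t)+Bw(t),\quad z(t)=Cx(t)+Dw(t),\quad w(t)=\Phi(z(t)),$$ with state $x(t)\in\mathbb{R}^n$. When $\|D\|<1$ and $\Phi\in\mathbf{\Phi}_{0,1}^m$, this system is well-posed. The system $\Sigma$ is said to be stable if the origin $x=0$ is globally asymptotically stable. *)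

theory Defs
  imports "HOL-Analysis.Analysis"
begin

definition He :: "real^'k^'k \<Rightarrow> real^'k^'k" where
  "He S = S + transpose S"

definition psd_matrices :: "(real^'k^'k) set" where
  "psd_matrices = {S. transpose S = S \<and> (\<forall>v. 0 \<le> v \<bullet> (S *v v))}"

definition nonneg_vectors :: "(real^'m) set" where
  "nonneg_vectors = {v. \<forall>i. 0 \<le> v $ i}"

definition hurwitz :: "real^'n^'n \<Rightarrow> bool" where
  "hurwitz A \<longleftrightarrow>
    (\<forall>(l::complex) (v::complex^'n).
       v \<noteq> 0 \<and> map_matrix complex_of_real A *v v = l *s v \<longrightarrow> Re l < 0)"

definition outer :: "real^'p \<Rightarrow> real^'q \<Rightarrow> real^'q^'p" where
  "outer u v = (\<chi> i j. u $ i * v $ j)"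

text \<open>
  Block vectors and matrices are indexed by a sum type: \<open>Inl\<close> selects the first block,
  \<open>Inr\<close> the second. A \<open>p \<times> q\<close> matrix has type \<open>real^'q^'p\<close>, so \<open>hcat\<close> concatenates column
  indices and \<open>vcat\<close> concatenates row indices.
\<close>

definition stack :: "real^'n \<Rightarrow> real^'m \<Rightarrow> real^('n + 'm)" where
  "stack u v = (\<chi> k. case k of Inl i \<Rightarrow> u $ i | Inr j \<Rightarrow> v $ j)"

definition hcat :: "real^'n^'p \<Rightarrow> real^'m^'p \<Rightarrow> real^('n + 'm)^'p" where
  "hcat M N = (\<chi> i. stack (M $ i) (N $ i))"

definition vcat :: "real^'q^'n \<Rightarrow> real^'q^'m \<Rightarrow> real^'q^('n + 'm)" where
  "vcat M N = (\<chi> k. case k of Inl i \<Rightarrow> M $ i | Inr j \<Rightarrow> N $ j)"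

definition proj_diag :: "real^'m^'m \<Rightarrow> real^'m^'m" where
  "proj_diag M = (\<chi> i j. if i = j then M $ i $ j else 0)"

definition proj_offdiag :: "real^'m^'m \<Rightarrow> real^'m^'m" where
  "proj_offdiag M = (\<chi> i j. if i = j then 0 else M $ i $ j)"

definition Z0 :: "(real^'m^'m) set" where
  "Z0 = {X. (\<forall>i. X $ i $ i = 0) \<and> (\<forall>i j. i \<noteq> j \<longrightarrow> X $ i $ j \<le> 0)}"

definition slope :: "real \<Rightarrow> real \<Rightarrow> (real \<Rightarrow> real) set" where
  "slope \<mu> \<nu> =
    {\<phi>. \<phi> 0 = 0 \<and>
        (\<forall>p q. p \<noteq> q \<longrightarrow> \<mu> \<le> (\<phi> p - \<phi> q) / (p - q) \<and> (\<phi> p - \<phi> q) / (p - q) \<le> \<nu>)}"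

definition odd_fun :: "(real \<Rightarrow> real) \<Rightarrow> bool" where
  "odd_fun \<phi> \<longleftrightarrow> (\<forall>x. \<phi> (- x) = - \<phi> x)"

definition diag_map :: "(real \<Rightarrow> real) \<Rightarrow> real^'m \<Rightarrow> real^'m" where
  "diag_map \<phi> z = (\<chi> i. \<phi> (z $ i))"

definition Phi_slope :: "real \<Rightarrow> real \<Rightarrow> (real^'m \<Rightarrow> real^'m) set" where
  "Phi_slope \<mu> \<nu> = diag_map ` slope \<mu> \<nu>"

definition Phi_odd :: "(real^'m \<Rightarrow> real^'m) set" where
  "Phi_odd = diag_map ` {\<phi>. odd_fun \<phi>}"

text \<open>
  Classical solutions on \<open>[0, \<infinity>)\<close>; at time \<open>0\<close> the derivative is one-sided.
\<close>

definition trajectory ::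
  "real^'n^'n \<Rightarrow> real^'m^'n \<Rightarrow> real^'n^'m \<Rightarrow> real^'m^'m \<Rightarrow> (real^'m \<Rightarrow> real^'m) \<Rightarrow>
    (real \<Rightarrow> real^'n) \<Rightarrow> (real \<Rightarrow> real^'m) \<Rightarrow> (real \<Rightarrow> real^'m) \<Rightarrow> bool" where
  "trajectory A B C D \<Phi> x z w \<longleftrightarrow>
    (\<forall>t\<ge>0. (x has_vector_derivative (A *v x t + B *v w t)) (at t within {0..}) \<and>
           z t = C *v x t + D *v w t \<and>
           w t = \<Phi> (z t))"

definition state_trajectory ::
  "real^'n^'n \<Rightarrow> real^'m^'n \<Rightarrow> real^'n^'m \<Rightarrow> real^'m^'m \<Rightarrow> (real^'m \<Rightarrow> real^'m) \<Rightarrow>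
    (real \<Rightarrow> real^'n) \<Rightarrow> bool" where
  "state_trajectory A B C D \<Phi> x \<longleftrightarrow> (\<exists>z w. trajectory A B C D \<Phi> x z w)"

text \<open>
  Global asymptotic stability of the origin: Lyapunov stability together with global attractivity.
  Existence of trajectories is a matter of well-posedness and is not part of the definition.
\<close>

definition stable_system ::
  "real^'n^'n \<Rightarrow> real^'m^'n \<Rightarrow> real^'n^'m \<Rightarrow> real^'m^'m \<Rightarrow> (real^'m \<Rightarrow> real^'m) \<Rightarrow> bool" where
  "stable_system A B C D \<Phi> \<longleftrightarrow>
    (\<forall>\<epsilon>>0. \<exists>\<delta>>0. \<forall>x. state_trajectory A B C D \<Phi> x \<and> norm (x 0) < \<delta> \<longrightarrow>
        (\<forall>t\<ge>0. norm (x t) < \<epsilon>)) \<and>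
    (\<forall>x. state_trajectory A B C D \<Phi> x \<longrightarrow> (x \<longlongrightarrow> 0) at_top)"

end

theory Submission
  imports Defs
begin

text \<open>
  Since \<open>H\<close> has rank one, \<open>Y\<close> is the dyad of \<open>w\<close> and \<open>c = z - w\<close>. The multiplier constraints then
  read \<open>w\<^sub>i c\<^sub>i = f\<^sub>i + g\<^sub>i\<close> and \<open>\<bar>w\<^sub>i c\<^sub>j\<bar> \<le> f\<^sub>j + g\<^sub>i\<close>, so \<open>(w\<^sub>i \<plusminus> w\<^sub>j) (c\<^sub>i \<plusminus> c\<^sub>j) \<ge> 0\<close> for both signs:
  the points \<open>\<plusminus>(z\<^sub>i, w\<^sub>i)\<close> have pairwise slopes in \<open>[0, 1]\<close> and can be interpolated by an odd
  function. The Lyapunov equation forces \<open>A h\<^sub>1 + B h\<^sub>2 = 0\<close>, so \<open>h\<^sub>1\<close> is an equilibrium, and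
  \<open>\<parallel>D\<parallel> < 1\<close> makes the loop Lipschitz, whence uniqueness.
\<close>

section \<open>Block matrices and dyads\<close>

lemma hcat_mult_stack:
  fixes P :: "real^'n^'p" and Q :: "real^'m^'p"
  shows "hcat P Q *v stack u v = P *v u + Q *v v"
  by (simp add: hcat_def stack_def matrix_vector_mult_def vec_eq_iff
      UNIV_Plus_UNIV[symmetric] sum.Plus del: UNIV_Plus_UNIV)

lemma transpose_vcat: "transpose (vcat P Q) = hcat (transpose P) (transpose Q)"
  by (auto simp: vec_eq_iff transpose_def vcat_def hcat_def stack_def split: sum.split)

lemma mult_outer:
  fixes M :: "real^'p^'r"
  shows "M ** outer u v = outer (M *v u) v"
  by (simp add: vec_eq_iff outer_def matrix_matrix_mult_def matrix_vector_mult_def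
      sum_distrib_right mult.assoc)

lemma outer_mult:
  fixes N :: "real^'s^'q"
  shows "outer u v ** N = outer u (transpose N *v v)"
  by (simp add: vec_eq_iff outer_def matrix_matrix_mult_def matrix_vector_mult_def transpose_def
      sum_distrib_left mult_ac)

lemma transpose_outer: "transpose (outer u v) = outer v u"
  by (simp add: vec_eq_iff outer_def transpose_def mult.commute)

lemma outer_add_left: "outer (u + u') v = outer u v + outer u' v"
  by (simp add: vec_eq_iff outer_def algebra_simps)

text \<open>At an index \<open>k\<close> with \<open>h $ k\<close> nonzero, the entry
  \<open>(k, k)\<close> gives \<open>v $ k = 0\<close>. In column \<open>k\<close> the second
  summand then drops out, which kills every other entry of \<open>v\<close>.\<close>

lemma He_outer_eq_0:
  assumes "He (outer v h) = 0" and "h \<noteq> 0"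
  shows "v = 0"
proof -
  have eq: "v $ i * h $ j + h $ i * v $ j = 0" for i j
    using assms(1) unfolding He_def transpose_outer by (simp add: vec_eq_iff outer_def)
  obtain k where k: "h $ k \<noteq> 0"
    using assms(2) by (auto simp: vec_eq_iff)
  have "v $ k = 0"
    using eq[of k k] k by simp
  then show ?thesis
    using eq[of _ k] k by (simp add: vec_eq_iff)
qed

lemma block_outer:
  assumes "vcat (hcat H11 H12) (hcat H21 H22) = outer (stack u v) (stack u v)"
  shows "H11 = outer u u" "H12 = outer u v"
proof -
  have *: "vcat (hcat H11 H12) (hcat H21 H22) $ k $ l = stack u v $ k * stack u v $ l" for k l
    by (simp add: assms outer_def)
  show "H11 = outer u u"
    using *[of "Inl _" "Inl _"] by (simp add: vec_eq_iff vcat_def hcat_def stack_def outer_def)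
  show "H12 = outer u v"
    using *[of "Inl _" "Inr _"] by (simp add: vec_eq_iff vcat_def hcat_def stack_def outer_def)
qed

section \<open>Slope-restricted functions and odd interpolation\<close>

lemma slope_0_1_iff:
  "\<phi> \<in> slope 0 1 \<longleftrightarrow> \<phi> 0 = 0 \<and> (\<forall>p q. p \<le> q \<longrightarrow> \<phi> p \<le> \<phi> q \<and> \<phi> q - \<phi> p \<le> q - p)"
proof -
  have "(\<forall>p q. p \<noteq> q \<longrightarrow> 0 \<le> (\<phi> p - \<phi> q) / (p - q) \<and> (\<phi> p - \<phi> q) / (p - q) \<le> 1) \<longleftrightarrow>
    (\<forall>p q. p \<le> q \<longrightarrow> \<phi> p \<le> \<phi> q \<and> \<phi> q - \<phi> p \<le> q - p)" (is "?L \<longleftrightarrow> ?R")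
  proof
    assume L: ?L
    show ?R
    proof (intro allI impI)
      fix p q :: real
      assume "p \<le> q"
      then show "\<phi> p \<le> \<phi> q \<and> \<phi> q - \<phi> p \<le> q - p"
        using L[rule_format, of q p] by (cases "p = q") (auto simp: divide_simps)
    qed
  next
    assume R: ?R
    show ?L
    proof (intro allI impI)
      fix p q :: real
      assume "p \<noteq> q"
      then show "0 \<le> (\<phi> p - \<phi> q) / (p - q) \<and> (\<phi> p - \<phi> q) / (p - q) \<le> 1"
        using R[rule_format, of q p] R[rule_format, of p q]
        by (cases "p \<le> q") (auto simp: divide_simps)
    qed
  qed
  then show ?thesis
    by (simp add: slope_def)
qed

lemma slope_0_1_abs_diff_le:
  assumes "\<phi> \<in> slope 0 1"
  shows "\<bar>\<phi> p - \<phi> q\<bar> \<le> \<bar>p - q\<bar>"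
proof -
  have "\<phi> p \<le> \<phi> q \<and> \<phi> q - \<phi> p \<le> q - p" if "p \<le> q" for p q
    using assms that by (simp add: slope_0_1_iff)
  from this[of p q] this[of q p] show ?thesis
    by linarith
qed

text \<open>The function is the least interpolant, a maximum of ramps ending at the data points.\<close>

lemma monotone_nonexpansive_interpolation:
  fixes S :: "(real \<times> real) set"
  assumes "finite S" and "S \<noteq> {}"
    and comonotone: "\<And>a b a' b'. (a, b) \<in> S \<Longrightarrow> (a', b') \<in> S \<Longrightarrow>
      0 \<le> (b - b') * ((a - b) - (a' - b'))"
  obtains \<psi> where "\<And>p q. p \<le> q \<Longrightarrow> \<psi> p \<le> \<psi> q \<and> \<psi> q - \<psi> p \<le> q - p"
    and "\<And>a b. (a, b) \<in> S \<Longrightarrow> \<psi> a = b"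
proof -
  \<comment> \<open>For a data point \<open>s = (a, b)\<close> this is the smallest value at
    \<open>x\<close> that the constraints allow: at least \<open>b\<close> to the right of
    \<open>a\<close> by monotonicity, at least \<open>b - (a - x)\<close> to the left by
    nonexpansiveness.\<close>
  define r where "r x s = snd s - max 0 (fst s - x)" for x :: real and s :: "real \<times> real"
  define \<psi> where "\<psi> x = Max (r x ` S)" for x
  have fin: "finite (r x ` S)" "r x ` S \<noteq> {}" for x
    using assms by auto
  have upper: "r x s \<le> \<psi> x" if "s \<in> S" for x s
    using fin that by (auto simp: \<psi>_def)
  have attained: "\<exists>s\<in>S. \<psi> x = r x s" for x
    using Max_in[OF fin] by (auto simp: \<psi>_def)
  have 1: "\<psi> p \<le> \<psi> q \<and> \<psi> q - \<psi> p \<le> q - p" if "p \<le> q" for p q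
  proof
    \<comment> \<open>The ramp attaining the maximum at one point bounds \<open>\<psi>\<close> from
      below at the other, so both estimates reduce to those of a single ramp.\<close>
    obtain s where "s \<in> S" "\<psi> p = r p s" using attained by blast
    then show "\<psi> p \<le> \<psi> q"
      using upper[of s q] that by (auto simp: r_def)
    obtain s where "s \<in> S" "\<psi> q = r q s" using attained by blast
    then show "\<psi> q - \<psi> p \<le> q - p"
      using upper[of s p] that by (auto simp: r_def max_def split: if_splits)
  qed
  have 2: "\<psi> a = b" if "(a, b) \<in> S" for a b
  proof (rule antisym)
    show "b \<le> \<psi> a"
      using upper[OF that, of a] by (simp add: r_def)
    obtain a' b' where s: "(a', b') \<in> S" "\<psi> a = r a (a', b')"
      using attained by (metis surj_pair)
    have c: "0 \<le> (b - b') * ((a - b) - (a' - b'))"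
      using comonotone[OF that s(1)] .
    show "\<psi> a \<le> b"
    proof (rule ccontr)
      assume "\<not> \<psi> a \<le> b"
      \<comment> \<open>A ramp overshooting at \<open>a\<close> makes \<open>b - b'\<close> negative
        and \<open>(a - b) - (a' - b')\<close> positive, against comonotonicity.\<close>
      then have "b < b'" "b < b' - (a' - a)"
        using s(2) by (auto simp: r_def max_def split: if_splits)
      then have "(b - b') * ((a - b) - (a' - b')) < 0"
        by (intro mult_neg_pos) auto
      with c show False by simp
    qed
  qed
  show thesis
    using that 1 2 by blast
qed

text \<open>In the data set closed under negation, \<open>minus\<close> compares points of equal
  sign and \<open>plus\<close> points of opposite sign. Consistency is included: if
  \<open>z i = z j\<close>, then \<open>minus\<close> reads
  \<open>0 \<le> - (w i - w j)^2\<close>.\<close>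

lemma odd_slope_interpolation:
  fixes z w :: "'i::finite \<Rightarrow> real"
  assumes minus: "\<And>i j. 0 \<le> (w i - w j) * ((z i - w i) - (z j - w j))"
    and plus: "\<And>i j. 0 \<le> (w i + w j) * ((z i - w i) + (z j - w j))"
  obtains \<phi> where "odd_fun \<phi>" "\<phi> \<in> slope 0 1" "\<And>i. \<phi> (z i) = w i"
proof -
  let ?S = "range (\<lambda>i. (z i, w i)) \<union> range (\<lambda>i. (- z i, - w i))"
  have "0 \<le> (b - b') * ((a - b) - (a' - b'))" if S: "(a, b) \<in> ?S" "(a', b') \<in> ?S" for a b a' b'
  proof -
    obtain i where i: "a = z i \<and> b = w i \<or> a = - z i \<and> b = - w i"
      using S(1) by auto
    obtain j where j: "a' = z j \<and> b' = w j \<or> a' = - z j \<and> b' = - w j"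
      using S(2) by auto
    show ?thesis
      using i j minus[of i j] plus[of i j]
      by (elim disjE conjE) (simp_all add: algebra_simps)
  qed
  then obtain \<psi> where \<psi>: "\<And>p q. p \<le> q \<Longrightarrow> \<psi> p \<le> \<psi> q \<and> \<psi> q - \<psi> p \<le> q - p"
    "\<And>a b. (a, b) \<in> ?S \<Longrightarrow> \<psi> a = b"
    by (rule monotone_nonexpansive_interpolation[of ?S, rotated 2]) auto
  \<comment> \<open>The least interpolant need not be odd. Its odd part averages
    \<open>\<psi> x\<close> and \<open>- \<psi> (- x)\<close>, both monotone, nonexpansive and
    interpolating the symmetric data.\<close>
  define \<phi> where "\<phi> x = (\<psi> x - \<psi> (- x)) / 2" for x
  show thesis
  proof
    show "odd_fun \<phi>"
      by (simp add: odd_fun_def \<phi>_def field_simps)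
    show "\<phi> \<in> slope 0 1"
      unfolding slope_0_1_iff
    proof (intro conjI allI impI)
      fix p q :: real
      assume "p \<le> q"
      with \<psi>(1)[of p q] \<psi>(1)[of "- q" "- p"]
      show "\<phi> p \<le> \<phi> q" "\<phi> q - \<phi> p \<le> q - p"
        by (auto simp: \<phi>_def field_simps)
    qed (simp add: \<phi>_def)
    show "\<phi> (z i) = w i" for i
      using \<psi>(2)[of "z i" "w i"] \<psi>(2)[of "- z i" "- w i"] by (simp add: \<phi>_def)
  qed
qed

section \<open>Uniqueness of the trajectory starting at an equilibrium\<close>

lemma norm_diag_map_diff_le:
  fixes z z' :: "real^'m"
  assumes "\<phi> \<in> slope 0 1"
  shows "norm (diag_map \<phi> z - diag_map \<phi> z') \<le> norm (z - z')"
  by (rule norm_le_componentwise_cart)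
    (simp add: diag_map_def slope_0_1_abs_diff_le[OF assms])

lemma Gronwall_zero:
  fixes y y' :: "real \<Rightarrow> 'a::real_inner"
  assumes deriv: "\<And>t. 0 \<le> t \<Longrightarrow> (y has_vector_derivative y' t) (at t within {0..})"
    and bound: "\<And>t. 0 \<le> t \<Longrightarrow> norm (y' t) \<le> K * norm (y t)"
    and "y 0 = 0" and "0 \<le> t"
  shows "y t = 0"
proof -
  \<comment> \<open>The weight absorbs the growth rate \<open>2 * K\<close> of the squared norm, so
    \<open>u\<close> has nonpositive derivative; one application of the mean value theorem from
    \<open>u 0 = 0\<close> then suffices.\<close>
  define u where "u s = (y s \<bullet> y s) * exp (- (2 * K * s))" for s
  define u' where "u' s = (2 * (y s \<bullet> y' s) - 2 * K * (y s \<bullet> y s)) * exp (- (2 * K * s))" for s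
  have "(u has_real_derivative u' s) (at s within {0..})" if "0 \<le> s" for s
  proof -
    have "((\<lambda>s. y s \<bullet> y s) has_derivative (\<lambda>h. y s \<bullet> (h *\<^sub>R y' s) + (h *\<^sub>R y' s) \<bullet> y s))
        (at s within {0..})"
      using deriv[OF that] unfolding has_vector_derivative_def
      by (intro has_derivative_inner)
    then have "((\<lambda>s. y s \<bullet> y s) has_real_derivative 2 * (y s \<bullet> y' s)) (at s within {0..})"
      unfolding has_field_derivative_def
      by (rule has_derivative_eq_rhs) (auto simp: inner_commute)
    then show ?thesis
      unfolding u_def u'_def
      by (auto intro!: derivative_eq_intros simp: algebra_simps)
  qed
  then have "(u has_derivative (\<lambda>h. u' s * h)) (at s within {0..t})" if "0 \<le> s" for s
    using that has_derivative_subset[of u _ s "{0..}" "{0..t}"]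
    by (auto simp: has_field_derivative_def)
  then obtain s where s: "s \<in> {0..t}" "u t - u 0 = u' s * (t - 0)"
    using mvt_very_simple[OF \<open>0 \<le> t\<close>, of u "\<lambda>s h. u' s * h"] by auto
  have "y s \<bullet> y' s \<le> norm (y s) * norm (y' s)"
    by (rule norm_cauchy_schwarz)
  also have "\<dots> \<le> norm (y s) * (K * norm (y s))"
    using bound s by (intro mult_left_mono) auto
  also have "\<dots> = K * (y s \<bullet> y s)"
    by (simp add: dot_square_norm power2_eq_square)
  finally have "u' s \<le> 0"
    by (simp add: u'_def mult_nonpos_nonneg)
  then have "u t \<le> 0"
    using s \<open>0 \<le> t\<close> \<open>y 0 = 0\<close> by (simp add: u_def mult_nonpos_nonneg)
  then show ?thesis
    using inner_ge_zero[of "y t"] by (simp add: u_def mult_le_0_iff)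
qed

text \<open>The algebraic loop is a contraction, so the deviation of \<open>z\<close> is controlled
  by that of \<open>x\<close>. The derivative of \<open>x t - e\<close> is therefore linearly
  bounded by \<open>x t - e\<close>, and \<open>Gronwall_zero\<close> applies.\<close>

lemma trajectory_unique_equilibrium:
  fixes A :: "real^'n^'n" and B :: "real^'m^'n" and C :: "real^'n^'m" and D :: "real^'m^'m"
  assumes D: "onorm ((*v) D) < 1"
    and \<Phi>: "\<And>z z'. norm (\<Phi> z - \<Phi> z') \<le> norm (z - z')"
    and equilibrium: "A *v e + B *v \<Phi> ze = 0" "ze = C *v e + D *v \<Phi> ze"
    and x: "state_trajectory A B C D \<Phi> x" "x 0 = e" and "0 \<le> t"
  shows "x t = e"
proof -
  obtain z w where traj:
    "\<And>t. 0 \<le> t \<Longrightarrow> (x has_vector_derivative (A *v x t + B *v w t)) (at t within {0..})"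
    "\<And>t. 0 \<le> t \<Longrightarrow> z t = C *v x t + D *v w t"
    "\<And>t. 0 \<le> t \<Longrightarrow> w t = \<Phi> (z t)"
    using x(1) unfolding state_trajectory_def trajectory_def by blast
  note bounded = matrix_vector_mul_bounded_linear
  let ?d = "1 - onorm ((*v) D)"
  let ?K = "onorm ((*v) A) + onorm ((*v) B) * (onorm ((*v) C) / ?d)"
  have "norm (A *v x t + B *v w t) \<le> ?K * norm (x t - e)" if "0 \<le> t" for t
  proof -
    have w: "norm (w t - \<Phi> ze) \<le> norm (z t - ze)"
      using traj(3)[OF that] \<Phi> by simp
    have "z t - ze = C *v (x t - e) + D *v (w t - \<Phi> ze)"
      using arg_cong2[of _ _ _ _ "(-)", OF traj(2)[OF that] equilibrium(2)]
      by (simp only: matrix_vector_mult_diff_distrib add_diff_add)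
    then have "norm (z t - ze) \<le> norm (C *v (x t - e)) + norm (D *v (w t - \<Phi> ze))"
      by (metis norm_triangle_ineq)
    also have "\<dots> \<le> onorm ((*v) C) * norm (x t - e) + onorm ((*v) D) * norm (w t - \<Phi> ze)"
      by (intro add_mono onorm[OF bounded])
    also have "\<dots> \<le> onorm ((*v) C) * norm (x t - e) + onorm ((*v) D) * norm (z t - ze)"
      by (intro add_left_mono mult_left_mono w onorm_pos_le[OF bounded])
    \<comment> \<open>The \<open>D\<close> term moves to the left-hand side, leaving the positive
      factor \<open>?d\<close>.\<close>
    finally have "norm (z t - ze) \<le> onorm ((*v) C) / ?d * norm (x t - e)"
      using D by (simp add: field_simps)
    with w have w': "norm (w t - \<Phi> ze) \<le> onorm ((*v) C) / ?d * norm (x t - e)"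
      by linarith
    \<comment> \<open>Subtracting the vanishing equilibrium field expresses the derivative through
      deviations only.\<close>
    have "A *v x t + B *v w t = A *v (x t - e) + B *v (w t - \<Phi> ze)"
      using equilibrium(1) by (simp add: matrix_vector_mult_diff_distrib algebra_simps)
    then have "norm (A *v x t + B *v w t) \<le> norm (A *v (x t - e)) + norm (B *v (w t - \<Phi> ze))"
      by (simp add: norm_triangle_ineq)
    also have "\<dots> \<le> onorm ((*v) A) * norm (x t - e) + onorm ((*v) B) * norm (w t - \<Phi> ze)"
      by (intro add_mono onorm[OF bounded])
    also have "\<dots> \<le> onorm ((*v) A) * norm (x t - e)
        + onorm ((*v) B) * (onorm ((*v) C) / ?d * norm (x t - e))"
      by (intro add_left_mono mult_left_mono w' onorm_pos_le[OF bounded])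
    also have "\<dots> = ?K * norm (x t - e)"
      by (simp only: distrib_right mult.assoc)
    finally show ?thesis .
  qed
  moreover have "((\<lambda>t. x t - e) has_vector_derivative (A *v x t + B *v w t)) (at t within {0..})"
    if "0 \<le> t" for t
    using has_vector_derivative_diff[OF traj(1)[OF that] has_vector_derivative_const[of e]]
    by simp
  ultimately have "x t - e = 0"
    using Gronwall_zero[of "\<lambda>t. x t - e" "\<lambda>t. A *v x t + B *v w t" ?K t] x(2) \<open>0 \<le> t\<close>
    by simp
  then show ?thesis
    by simp
qed

section \<open>From the rank-one multiplier to a destabilizing nonlinearity\<close>

theorem theorem2:
  fixes A :: "real^'n^'n" and B :: "real^'m^'n" and C :: "real^'n^'m" and D :: "real^'m^'m"
    and H :: "real^('n + 'm)^('n + 'm)"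
    and H11 :: "real^'n^'n" and H12 :: "real^'m^'n" and H22 :: "real^'m^'m"
    and f g :: "real^'m" and X Z Y :: "real^'m^'m"
    and h1 :: "real^'n" and h2 zstar wstar :: "real^'m"
  assumes "hurwitz A"
    and "onorm ((*v) D) < 1"
    and "H \<in> psd_matrices"
    and "f \<in> nonneg_vectors" and "g \<in> nonneg_vectors"
    and "X \<in> Z0" and "Z \<in> Z0"
    and "\<not> (H = 0 \<and> f = 0 \<and> g = 0 \<and> X = 0 \<and> Z = 0)"
    and "H = vcat (hcat H11 H12) (hcat (transpose H12) H22)"
    and "H11 \<in> psd_matrices" and "H22 \<in> psd_matrices"
    and "Y = hcat 0 (mat 1) ** H ** vcat (transpose C) (transpose D - mat 1)"
    and "He (A ** H11 + B ** transpose H12) = 0"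
    and "proj_diag Y = proj_diag (outer (vec 1) f + outer g (vec 1))"
    and "proj_offdiag Y = proj_offdiag (X - Z)"
    and "proj_offdiag (X + Z) = - proj_offdiag (outer (vec 1) f + outer g (vec 1))"
    and "rank H = 1"
    and "H = outer (stack h1 h2) (stack h1 h2)"
    and "zstar = C *v h1 + D *v h2"
    and "wstar = h2"
  shows "h1 \<noteq> 0 \<and>
         (\<exists>\<phi>. odd_fun \<phi> \<and> \<phi> \<in> slope 0 1 \<and>
           (\<forall>i. \<phi> (zstar $ i) = wstar $ i \<and> \<phi> (- (zstar $ i)) = - (wstar $ i))) \<and>
         (\<forall>\<phi>. odd_fun \<phi> \<and> \<phi> \<in> slope 0 1 \<and>
           (\<forall>i. \<phi> (zstar $ i) = wstar $ i \<and> \<phi> (- (zstar $ i)) = - (wstar $ i)) \<longrightarrow>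
         (diag_map \<phi> :: real^'m \<Rightarrow> real^'m) \<in> Phi_slope 0 1 \<inter> Phi_odd \<and>
         \<not> stable_system A B C D (diag_map \<phi>) \<and>
         state_trajectory A B C D (diag_map \<phi>) (\<lambda>t. h1) \<and>
         (\<forall>x. state_trajectory A B C D (diag_map \<phi>) x \<and> x 0 = h1 \<longrightarrow> (\<forall>t\<ge>0. x t = h1)))"
proof -
  define c where "c = zstar - wstar"
  have H11: "H11 = outer h1 h1" and H12: "H12 = outer h1 h2"
    by (rule block_outer[OF assms(9)[symmetric, unfolded assms(18)]])+

  have "Y = outer (hcat 0 (mat 1) *v stack h1 h2)
      (transpose (vcat (transpose C) (transpose D - mat 1)) *v stack h1 h2)"
    by (simp only: assms(12,18) mult_outer outer_mult)
  also have "hcat 0 (mat 1) *v stack h1 h2 = wstar"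
    by (simp add: hcat_mult_stack assms(20))
  also have "transpose (vcat (transpose C) (transpose D - mat 1)) = hcat C (D - mat 1)"
  proof -
    have "transpose (transpose D - mat 1) = D - mat 1"
      by (auto simp: transpose_def vec_eq_iff mat_def)
    then show ?thesis
      by (simp add: transpose_vcat)
  qed
  also have "hcat C (D - mat 1) *v stack h1 h2 = c"
    by (simp add: hcat_mult_stack c_def assms(19,20) matrix_vector_mult_diff_rdistrib)
  finally have Y: "Y $ i $ j = wstar $ i * c $ j" for i j
    by (simp add: outer_def)

  have diag: "wstar $ i * c $ i = f $ i + g $ i" for i
    using arg_cong[OF assms(14), of "\<lambda>M. M $ i $ i"] by (simp add: proj_diag_def outer_def Y)
  have nonneg: "0 \<le> wstar $ i * c $ i" for i
    using assms(4,5) by (simp add: diag nonneg_vectors_def)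
  \<comment> \<open>For nonpositive entries the absolute value of \<open>X - Z\<close> is at most
    \<open>-(X + Z)\<close>.\<close>
  have offdiag: "\<bar>wstar $ i * c $ j\<bar> \<le> f $ j + g $ i" if "i \<noteq> j" for i j
  proof -
    have "wstar $ i * c $ j = X $ i $ j - Z $ i $ j"
      using arg_cong[OF assms(15), of "\<lambda>M. M $ i $ j"] that by (simp add: proj_offdiag_def Y)
    moreover have "X $ i $ j + Z $ i $ j = - (f $ j + g $ i)"
      using arg_cong[OF assms(16), of "\<lambda>M. M $ i $ j"] that
      by (simp add: proj_offdiag_def outer_def)
    moreover have "X $ i $ j \<le> 0" "Z $ i $ j \<le> 0"
      using assms(6,7) that by (auto simp: Z0_def)
    ultimately show ?thesis
      by linarith
  qed

  \<comment> \<open>If \<open>h1 = 0\<close>, then \<open>zstar = D *v wstar\<close> is strictly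
    shorter than \<open>wstar\<close>, while summing \<open>nonneg\<close> gives
    \<open>wstar \<bullet> wstar \<le> zstar \<bullet> wstar\<close>, contradicting
    Cauchy-Schwarz.\<close>
  have h1: "h1 \<noteq> 0"
  proof
    assume "h1 = 0"
    have "wstar \<noteq> 0"
    proof
      assume "wstar = 0"
      then have "stack h1 h2 = 0"
        using \<open>h1 = 0\<close> assms(20) by (auto simp: stack_def vec_eq_iff split: sum.split)
      then have "H = 0"
        by (simp add: assms(18) outer_def vec_eq_iff)
      then show False
        using assms(17) by (simp add: rank_0)
    qed
    have "zstar = D *v wstar"
      by (simp add: assms(19,20) \<open>h1 = 0\<close>)
    then have "norm zstar \<le> onorm ((*v) D) * norm wstar"
      by (simp add: onorm[OF matrix_vector_mul_bounded_linear])
    also have "\<dots> < norm wstar"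
      using assms(2) \<open>wstar \<noteq> 0\<close> by simp
    finally have "norm zstar * norm wstar < norm wstar * norm wstar"
      using \<open>wstar \<noteq> 0\<close> by simp
    moreover have "0 \<le> wstar \<bullet> c"
      by (simp add: inner_vec_def sum_nonneg nonneg)
    then have "wstar \<bullet> wstar \<le> zstar \<bullet> wstar"
      by (simp add: c_def inner_diff_right inner_commute)
    moreover have "zstar \<bullet> wstar \<le> norm zstar * norm wstar"
      by (rule norm_cauchy_schwarz)
    ultimately show False
      by (simp add: dot_square_norm power2_eq_square)
  qed

  \<comment> \<open>The two off-diagonal bounds \<open>f $ j + g $ i\<close> and
    \<open>f $ i + g $ j\<close> add up to the sum of the two diagonal values.\<close>
  have cross: "\<bar>wstar $ i * c $ j + wstar $ j * c $ i\<bar> \<le> wstar $ i * c $ i + wstar $ j * c $ j"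
    for i j
  proof (cases "i = j")
    case True
    then show ?thesis using nonneg[of j] by (simp add: mult.commute)
  next
    case False
    then show ?thesis
      using offdiag[OF False] offdiag[OF False[symmetric]] diag[of i] diag[of j] by linarith
  qed
  have minus: "0 \<le> (wstar $ i - wstar $ j) * ((zstar $ i - wstar $ i) - (zstar $ j - wstar $ j))"
    and plus: "0 \<le> (wstar $ i + wstar $ j) * ((zstar $ i - wstar $ i) + (zstar $ j - wstar $ j))"
    for i j
    using cross[of i j] unfolding c_def vector_minus_component
    by (simp_all add: algebra_simps abs_le_iff)
  obtain \<phi>0 where \<phi>0: "odd_fun \<phi>0" "\<phi>0 \<in> slope 0 1" "\<And>i. \<phi>0 (zstar $ i) = wstar $ i"
    using minus plus
    by (rule odd_slope_interpolation[of "($) wstar" "($) zstar"]) (rule that)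

  \<comment> \<open>With both blocks of \<open>H\<close> dyads ending in \<open>h1\<close> after
    transposition, the Lyapunov term collapses to a single dyad.\<close>
  have "He (outer (A *v h1 + B *v h2) h1) = 0"
    using assms(13) by (simp add: H11 H12 transpose_outer mult_outer outer_add_left)
  then have equilibrium: "A *v h1 + B *v h2 = 0"
    using He_outer_eq_0 h1 by blast

  have "(diag_map \<phi> :: real^'m \<Rightarrow> real^'m) \<in> Phi_slope 0 1 \<inter> Phi_odd \<and>
      \<not> stable_system A B C D (diag_map \<phi>) \<and>
      state_trajectory A B C D (diag_map \<phi>) (\<lambda>t. h1) \<and>
      (\<forall>x. state_trajectory A B C D (diag_map \<phi>) x \<and> x 0 = h1 \<longrightarrow> (\<forall>t\<ge>0. x t = h1))"
    if "odd_fun \<phi>" "\<phi> \<in> slope 0 1" "\<And>i. \<phi> (zstar $ i) = wstar $ i" for \<phi>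
  proof (intro conjI)
    have w: "diag_map \<phi> zstar = h2"
      using that(3) by (simp add: diag_map_def vec_eq_iff assms(20))
    show "(diag_map \<phi> :: real^'m \<Rightarrow> real^'m) \<in> Phi_slope 0 1 \<inter> Phi_odd"
      using that by (auto simp: Phi_slope_def Phi_odd_def)
    show traj: "state_trajectory A B C D (diag_map \<phi>) (\<lambda>t. h1)"
      unfolding state_trajectory_def trajectory_def
      by (rule exI[of _ "\<lambda>t. zstar"], rule exI[of _ "\<lambda>t. h2"])
        (simp add: equilibrium w w[unfolded assms(19)] assms(19))
    \<comment> \<open>Attractivity is what fails: a nonzero constant trajectory does not tend to the
      origin.\<close>
    have "\<not> ((\<lambda>t::real. h1) \<longlongrightarrow> 0) at_top"
      using h1 by (simp add: tendsto_const_iff)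
    then show "\<not> stable_system A B C D (diag_map \<phi>)"
      using traj by (auto simp: stable_system_def)
    show "\<forall>x. state_trajectory A B C D (diag_map \<phi>) x \<and> x 0 = h1 \<longrightarrow> (\<forall>t\<ge>0. x t = h1)"
    proof (intro allI impI, elim conjE)
      fix x and t :: real
      assume "state_trajectory A B C D (diag_map \<phi>) x" "x 0 = h1" "0 \<le> t"
      moreover have "A *v h1 + B *v diag_map \<phi> zstar = 0"
        and "zstar = C *v h1 + D *v diag_map \<phi> zstar"
        unfolding w by (fact equilibrium, fact assms(19))
      ultimately show "x t = h1"
        using trajectory_unique_equilibrium[OF assms(2) norm_diag_map_diff_le[OF that(2)]]
        by blast
    qed
  qed
  \<comment> \<open>The values at \<open>- (zstar $ i)\<close> come from oddness.\<close>
  then show ?thesis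
    using h1 \<phi>0 by (auto simp: odd_fun_def)
qed

end
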